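(* Let $E$ be a compact subset of $\mathbf{R}$, let $m$ be a positive integer, let $\alpha \in [0,1]$, and let $D$, $\varphi$, $\delta$, $\Omega$ and $f_\omega : \mathbf{R}\to\mathbf{R}$ be as defined in the context. Then $f_\omega$ is a $C^{m+\alpha}$-diffeomorphism for every $\omega \in \Omega$, and the family $\{f_\omega^{(m)}\}_{\omega\in\Omega}$ of $m$-th derivatives is uniformly equicontinuous with modulus $2\|\varphi^{(m+1)}\|_\infty\,\delta$; that is, $$\left|f_\omega^{(m)}(y) - f_\omega^{(m)}(x)\right| \leq 2\|\varphi^{(m+1)}\|_\infty\,\delta(|y-x|)$$ for all $\omega\in\Omega$ and all $x,y\in\mathbf{R}$.
   Context: Let $D$ be the (countable) set of bounded connected components of $\mathbf{R}\setminus E$, and for $U \in D$ let $|U|$ denote the length of the open interval $U$. Define $\delta : [0,\infty)\to[0,\infty)$ by $\delta(0) = 0$ and, for $t > 0$, $$\delta(t) = \frac{1}{\max(-\log t, \log 2)} \ \text{ if } \alpha = 0, \qquad \delta(t) = t^\alpha \ \text{ if } \alpha\in(0,1].$$ For $U\in D$ let $\delta_U = |U|^m\,\delta(|U|)$, and let $\Omega = \prod_{U\in D}[0,\delta_U]$. Let $\varphi$ be an increasing (that is, nondecreasing) $C^\infty$-function on $\mathbf{R}$ that is $0$ on $(-\infty,0]$ and $1$ on $[1,\infty)$. For $\omega = (\omega_U)_{U\in D}\in\Omega$ define $f_\omega:\mathbf{R}\to\mathbf{R}$ by $$f_\omega(x) = x + \sum_{U\in D}\omega_U\,\varphi\left(\frac{x-\inf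 U}{|U|}\right).$$ A $C^{m+\alpha}$-diffeomorphism $f : \mathbf{R} \to \mathbf{R}$ is a bijection such that $f$ and $f^{-1}$ are $m$ times continuously differentiable and, if $\alpha > 0$, the $m$-th derivatives of $f$ and $f^{-1}$ are Hölder continuous with exponent $\alpha$ (a function $g$ is Hölder continuous with exponent $\alpha$ if there is a constant $K$ with $|g(y)-g(x)| \leq K|y-x|^\alpha$ for all $x, y \in \mathbf{R}$). *)

theory Defs
  imports "HOL-Analysis.Analysis"
begin

definition C_k :: "nat \<Rightarrow> (real \<Rightarrow> real) \<Rightarrow> bool" where
  "C_k k f \<longleftrightarrow>
     (\<forall>i<k. \<forall>x. (deriv ^^ i) f differentiable (at x)) \<and>
     continuous_on UNIV ((deriv ^^ k) f)"

definition C_infinity :: "(real \<Rightarrow> real) \<Rightarrow> bool" where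
  "C_infinity f \<longleftrightarrow> (\<forall>k. C_k k f)"

definition Hoelder_continuous :: "real \<Rightarrow> (real \<Rightarrow> real) \<Rightarrow> bool" where
  "Hoelder_continuous \<alpha> g \<longleftrightarrow>
     (\<exists>K. \<forall>x y. \<bar>g y - g x\<bar> \<le> K * \<bar>y - x\<bar> powr \<alpha>)"

definition diffeomorphism :: "nat \<Rightarrow> real \<Rightarrow> (real \<Rightarrow> real) \<Rightarrow> bool" where
  "diffeomorphism m \<alpha> f \<longleftrightarrow>
     bij f \<and> C_k m f \<and> C_k m (inv f) \<and>
     (\<alpha> > 0 \<longrightarrow> Hoelder_continuous \<alpha> ((deriv ^^ m) f) \<and>
                Hoelder_continuous \<alpha> ((deriv ^^ m) (inv f)))"

text \<open>A conditionally complete supremum, hence meaningful only for bounded functions. It is applied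
  to derivatives of order at least 1 of the bump profile, which are continuous and vanish
  outside the unit interval.\<close>

definition sup_norm :: "(real \<Rightarrow> real) \<Rightarrow> real" where
  "sup_norm g = (SUP x. \<bar>g x\<bar>)"

definition bounded_gaps :: "real set \<Rightarrow> real set set" where
  "bounded_gaps E = {U \<in> components (- E). bounded U}"

text \<open>For a bounded gap \<open>U\<close> of a closed set, an open interval, this is the distance between its
  endpoints.\<close>

definition gap_length :: "real set \<Rightarrow> real" where
  "gap_length U = Sup U - Inf U"

text \<open>Only arguments \<open>t \<ge> 0\<close> matter.\<close>

definition modulus :: "real \<Rightarrow> real \<Rightarrow> real" where
  "modulus \<alpha> t =
     (if t = 0 then 0
      else if \<alpha> = 0 then 1 / max (- ln t) (ln 2)
      else t powr \<alpha>)"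

definition gap_bound :: "nat \<Rightarrow> real \<Rightarrow> real set \<Rightarrow> real" where
  "gap_bound m \<alpha> U = gap_length U ^ m * modulus \<alpha> (gap_length U)"

definition parameters :: "real set \<Rightarrow> nat \<Rightarrow> real \<Rightarrow> (real set \<Rightarrow> real) set" where
  "parameters E m \<alpha> = (\<Pi>\<^sub>E U\<in>bounded_gaps E. {0..gap_bound m \<alpha> U})"

text \<open>The terms of the sum are nonnegative and dominated by a constant multiple of the gap lengths,
  whose sum over all bounded gaps of a compact set is finite, so for \<open>m \<ge> 1\<close> the unordered
  sum converges for all parameters.\<close>

definition f_param :: "real set \<Rightarrow> (real \<Rightarrow> real) \<Rightarrow> (real set \<Rightarrow> real) \<Rightarrow> real \<Rightarrow> real" where
  "f_param E \<phi> \<omega> x =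
     x + (\<Sum>\<^sub>\<infinity>U\<in>bounded_gaps E. \<omega> U * \<phi> ((x - Inf U) / gap_length U))"

end

(* Each derivative of order k >= 1 of the sum has at every point at most one nonzero term, supported in
   a gap U and with amplitude at most delta(|U|) when k = m. If x and y lie in the same gap, the mean
   value theorem bounds the oscillation; otherwise each of the two values is compared with the value 0
   at the nearest end of its gap, which is at distance at most min(|U|/2, |y - x|). The bound holds for
   all finite partial sums, and this equicontinuity justifies differentiating term by term. Since phi is
   nondecreasing, f' >= 1, so f is a bijection, and h = inverse of f inherits the regularity of f
   through h' = 1 / (f' o h). *)

theory Submission
  imports Defs
begin

text \<open>The delicate case is \<alpha> = 0. In a gap of length L the slope bound gives an
  oscillation \<open>modulus \<alpha> L * (s / L)\<close> over a distance s, and this has to be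
  compared with \<open>modulus \<alpha> s\<close>. For the logarithmic modulus the comparison holds
  when 2 s <= L and can fail otherwise: at L = 1/2 it fails for every s strictly between 1/4 and
  1/2. Hence the comparison with the nearer end of a gap. The constant 2 has two sources: the sum of
  two such comparisons, and the doubling bound for two points of one gap that are more than L/2
  apart. Equicontinuity is used at all orders 1, ..., m, since order k is differentiated by means of
  order k + 1; below order m the spare power of |U| is absorbed in a constant. Order 0 is
  exceptional: its terms do not vanish to the right of their gaps, so convergence rests on the
  summability of the gap lengths. For the inverse, f' rather than the unbounded f is placed in a
  class of bounded Hoelder functions that is closed under products, under reciprocals of functions
  that are at least 1, and under composition with suitable 1-Lipschitz maps.\<close>

section \<open>Estimates for the modulus\<close>

text \<open>The right side is the chord of the concave function \<open>ln\<close> through 1 and 2,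
  which lies above \<open>ln\<close> beyond 2. The case \<alpha> = 0 of the scaling bound reduces to
  this.\<close>

lemma ln_le_minus_one_mult_ln2:
  fixes l :: real
  assumes "2 \<le> l"
  shows "ln l \<le> (l - 1) * ln 2"
proof -
  have "ln l = ln 2 + ln (l / 2)"
    using assms by (simp add: ln_div)
  also have "\<dots> \<le> ln 2 + (l / 2 - 1)"
    using assms ln_le_minus_one[of "l / 2"] by simp
  also have "\<dots> \<le> ln 2 + (l - 2) * ln 2"
  proof -
    have "(l - 2) * (1 / 2) \<le> (l - 2) * ln (2::real)"
      using assms ln2_ge_two_thirds by (intro mult_left_mono) auto
    then show ?thesis by (simp add: field_simps)
  qed
  finally show ?thesis by (simp add: algebra_simps)
qed

lemma modulus_0 [simp]: "modulus \<alpha> 0 = 0"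
  by (simp add: modulus_def)

lemma max_ln2_pos: "0 < max x (ln (2::real))"
  by (simp add: less_max_iff_disj)

lemma modulus_nonneg: "0 \<le> modulus \<alpha> t"
  using less_imp_le[OF max_ln2_pos] by (auto simp: modulus_def)

lemma modulus_mono:
  assumes "0 \<le> \<alpha>" "0 \<le> s" "s \<le> t"
  shows "modulus \<alpha> s \<le> modulus \<alpha> t"
proof (cases "s = 0")
  case True
  then show ?thesis by (simp add: modulus_nonneg)
next
  case False
  with assms have st: "0 < s" "0 < t" "s \<le> t" by auto
  show ?thesis
  proof (cases "\<alpha> = 0")
    case True
    have "max (- ln t) (ln 2) \<le> max (- ln s) (ln 2)"
      using st by (intro max.mono) auto
    then have "1 / max (- ln s) (ln 2) \<le> 1 / max (- ln t) (ln 2)"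
      by (intro divide_left_mono mult_pos_pos max_ln2_pos) auto
    then show ?thesis using True st by (simp add: modulus_def)
  next
    case False
    then show ?thesis using st assms by (simp add: modulus_def powr_mono2)
  qed
qed

text \<open>The factor 2 between \<open>s\<close> and \<open>L\<close> matters: for \<open>\<alpha> = 0\<close> the quotient \<open>modulus 0 t / t\<close> increases
  on the interval between \<open>1/e\<close> and \<open>1/2\<close>.\<close>

lemma modulus_scale_le:
  assumes \<alpha>: "0 \<le> \<alpha>" "\<alpha> \<le> 1" and s: "0 \<le> s" "2 * s \<le> L"
  shows "modulus \<alpha> L * (s / L) \<le> modulus \<alpha> s"
proof (cases "s = 0")
  case True
  then show ?thesis by simp
next
  case False
  with s have sL: "0 < s" "0 < L" by auto
  show ?thesis
  proof (cases "\<alpha> = 0")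
    case True
    \<comment> \<open>In these variables the claim reads
      \<open>max a (ln 2) \<le> l * max (a - ln l) (ln 2)\<close>; the bound on \<open>a\<close>
      follows from \<open>key\<close> in either case of the right maximum.\<close>
    define l a where "l = L / s" and "a = - ln s"
    have l2: "2 \<le> l" using sL s by (simp add: l_def field_simps)
    have lnL: "- ln L = a - ln l"
      using sL by (simp add: l_def a_def ln_div)
    have key: "ln l \<le> (l - 1) * ln 2"
      using ln_le_minus_one_mult_ln2[OF l2] .
    have ln2: "0 < ln (2::real)" by simp
    have "a \<le> l * max (a - ln l) (ln 2)"
    proof (cases "ln 2 \<le> a - ln l")
      case True
      have "(l - 1) * (ln 2 + ln l) \<le> (l - 1) * a"
        using True l2 by (intro mult_left_mono) auto
      then have "a \<le> l * (a - ln l)"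
        using key by (simp add: algebra_simps)
      then show ?thesis using True by (simp add: max_def)
    next
      case False
      then have "a \<le> l * ln 2"
        using key by (simp add: algebra_simps)
      then show ?thesis using False by (simp add: max_def)
    qed
    moreover have "ln 2 \<le> l * max (a - ln l) (ln 2)"
    proof -
      have "1 * ln 2 \<le> l * max (a - ln l) (ln 2)"
        using l2 ln2 by (intro mult_mono) auto
      then show ?thesis by simp
    qed
    ultimately have "max (- ln s) (ln 2) \<le> l * max (- ln L) (ln 2)"
      by (simp add: lnL a_def)
    then have "1 / (l * max (- ln L) (ln 2)) \<le> 1 / max (- ln s) (ln 2)"
      using l2 by (intro divide_left_mono mult_pos_pos max_ln2_pos) auto
    then show ?thesis
      using True sL by (simp add: modulus_def l_def field_simps)
  next
    case False
    \<comment> \<open>The claim is equivalent to this monotonicity, where \<alpha> \<le> 1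
      enters.\<close>
    have "s powr (1 - \<alpha>) \<le> L powr (1 - \<alpha>)"
      using sL s \<alpha> by (intro powr_mono2) auto
    then have "L powr \<alpha> * s powr 1 \<le> L powr 1 * s powr \<alpha>"
      using sL by (simp add: powr_diff field_simps)
    then show ?thesis
      using False sL by (simp add: modulus_def field_simps)
  qed
qed

text \<open>The scaling bound at its extreme point \<open>s = L / 2\<close> says that halving the
  argument at most halves the modulus.\<close>

lemma modulus_le_twice:
  assumes "0 \<le> \<alpha>" "\<alpha> \<le> 1" "0 \<le> L" "L \<le> 2 * t"
  shows "modulus \<alpha> L \<le> 2 * modulus \<alpha> t"
proof (cases "L = 0")
  case True
  then show ?thesis by (simp add: modulus_nonneg)
next
  case False
  have "modulus \<alpha> L * (L / 2 / L) \<le> modulus \<alpha> (L / 2)"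
    using assms by (intro modulus_scale_le) auto
  also have "\<dots> \<le> modulus \<alpha> t"
    using assms by (intro modulus_mono) auto
  finally show ?thesis using False by simp
qed

text \<open>At \<alpha> = 0 this is what the logarithm achieves: a bound by \<open>t powr 0\<close>
  would give no continuity.\<close>

lemma modulus_tendsto_0:
  assumes "0 \<le> \<alpha>"
  shows "(modulus \<alpha> \<longlongrightarrow> 0) (at_right 0)"
proof (cases "\<alpha> = 0")
  case True
  have "filterlim (\<lambda>t::real. - ln t) at_top (at_right 0)"
    using ln_at_0 by (simp add: filterlim_uminus_at_bot)
  then have "filterlim (\<lambda>t::real. max (- ln t) (ln 2)) at_top (at_right 0)"
    by (rule filterlim_at_top_mono) (auto intro: always_eventually)
  then have "((\<lambda>t. inverse (max (- ln t) (ln 2))) \<longlongrightarrow> 0) (at_right (0::real))"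
    by (rule tendsto_inverse_0_at_top)
  then show ?thesis
    by (rule Lim_transform_eventually)
      (use True in \<open>auto simp: modulus_def inverse_eq_divide eventually_at_right_less
        intro!: eventually_mono[OF eventually_at_right_less[of "0::real"]]\<close>)
next
  case False
  have "((\<lambda>t. t powr \<alpha>) \<longlongrightarrow> 0 powr \<alpha>) (at_right (0::real))"
  proof (rule tendsto_powr')
    show "((\<lambda>t. t) \<longlongrightarrow> (0::real)) (at_right 0)" by (rule tendsto_ident_at)
    show "((\<lambda>t. \<alpha>) \<longlongrightarrow> \<alpha>) (at_right (0::real))" by simp
    show "(0::real) \<noteq> 0 \<or> 0 < \<alpha> \<and> (\<forall>\<^sub>F t in at_right (0::real). 0 \<le> t)"
      using False assms by (auto intro: eventually_mono[OF eventually_at_right_less[of "0::real"]])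
  qed
  then have "((\<lambda>t. t powr \<alpha>) \<longlongrightarrow> 0) (at_right (0::real))"
    by simp
  then show ?thesis
    by (rule Lim_transform_eventually)
      (use False in \<open>auto simp: modulus_def
        intro!: eventually_mono[OF eventually_at_right_less[of "0::real"]]\<close>)
qed

lemma tendsto_abs_diff_at_right_0:
  fixes x :: real
  shows "filterlim (\<lambda>y. \<bar>y - x\<bar>) (at_right 0) (at x)"
  unfolding filterlim_at
proof
  show "\<forall>\<^sub>F y in at x. \<bar>y - x\<bar> \<in> {0<..} \<and> \<bar>y - x\<bar> \<noteq> 0"
    by (auto simp: eventually_at intro!: exI[of _ 1])
  have "((\<lambda>y. \<bar>y - x\<bar>) \<longlongrightarrow> \<bar>x - x\<bar>) (at x)"
    by (intro tendsto_intros)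
  then show "((\<lambda>y. \<bar>y - x\<bar>) \<longlongrightarrow> 0) (at x)" by simp
qed

lemma continuous_on_if_modulus:
  fixes g :: "real \<Rightarrow> real"
  assumes "0 \<le> \<alpha>" and "\<And>x y. \<bar>g y - g x\<bar> \<le> K * modulus \<alpha> \<bar>y - x\<bar>"
  shows "continuous_on UNIV g"
proof -
  have "(g \<longlongrightarrow> g x) (at x)" for x
  proof (rule LIM_zero_cancel, rule Lim_null_comparison)
    show "\<forall>\<^sub>F y in at x. norm (g y - g x) \<le> K * modulus \<alpha> \<bar>y - x\<bar>"
      using assms(2) by simp
    have "((\<lambda>y. modulus \<alpha> \<bar>y - x\<bar>) \<longlongrightarrow> 0) (at x)"
      using filterlim_compose[OF modulus_tendsto_0[OF assms(1)] tendsto_abs_diff_at_right_0] .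
    then show "((\<lambda>y. K * modulus \<alpha> \<bar>y - x\<bar>) \<longlongrightarrow> 0) (at x)"
      by (auto intro: tendsto_mult_right_zero)
  qed
  then show ?thesis by (auto simp: continuous_on)
qed

section \<open>The algebra of bounded Hoelder functions\<close>

text \<open>Boundedness is included because a product of unbounded Hoelder functions may fail to be
  Hoelder. Continuity is listed separately because the Hoelder clause is void at \<alpha> = 0, as it
  is in \<open>diffeomorphism\<close>.\<close>

definition bounded_Hoelder :: "real \<Rightarrow> (real \<Rightarrow> real) \<Rightarrow> bool" where
  "bounded_Hoelder \<alpha> u \<longleftrightarrow> continuous_on UNIV u \<and> (\<exists>B. \<forall>x. \<bar>u x\<bar> \<le> B) \<and>
     (\<alpha> > 0 \<longrightarrow> Hoelder_continuous \<alpha> u)"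

text \<open>The recursion peels off the innermost derivative, so that the product and chain rules
  can be applied once and the induction hypothesis then used for other functions. Every order up to
  \<open>j\<close> is bounded Hoelder, not only the last.\<close>

primrec C_bounded_Hoelder :: "real \<Rightarrow> nat \<Rightarrow> (real \<Rightarrow> real) \<Rightarrow> bool" where
  "C_bounded_Hoelder \<alpha> 0 u = bounded_Hoelder \<alpha> u"
| "C_bounded_Hoelder \<alpha> (Suc j) u = (bounded_Hoelder \<alpha> u \<and>
     (\<forall>x. u differentiable (at x)) \<and> C_bounded_Hoelder \<alpha> j (deriv u))"

lemma Hoelder_continuous_nonnegE:
  assumes "Hoelder_continuous \<alpha> g"
  obtains K where "0 \<le> K" "\<And>x y. \<bar>g y - g x\<bar> \<le> K * \<bar>y - x\<bar> powr \<alpha>"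
proof -
  from assms obtain K where K: "\<And>x y. \<bar>g y - g x\<bar> \<le> K * \<bar>y - x\<bar> powr \<alpha>"
    unfolding Hoelder_continuous_def by blast
  have "\<bar>g y - g x\<bar> \<le> \<bar>K\<bar> * \<bar>y - x\<bar> powr \<alpha>" for x y
    by (rule order_trans[OF K]) (intro mult_right_mono; simp)
  then show ?thesis using that[of "\<bar>K\<bar>"] by simp
qed

lemma C_bounded_Hoelder_imp_bounded_Hoelder:
  "C_bounded_Hoelder \<alpha> j u \<Longrightarrow> bounded_Hoelder \<alpha> u"
  by (cases j) auto

lemma C_bounded_Hoelder_Suc_imp:
  "C_bounded_Hoelder \<alpha> (Suc j) u \<Longrightarrow> C_bounded_Hoelder \<alpha> j u"
proof (induction j arbitrary: u)
  case (Suc j)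
  then have "C_bounded_Hoelder \<alpha> (Suc j) (deriv u)" by simp
  then have "C_bounded_Hoelder \<alpha> j (deriv u)" by (rule Suc.IH)
  then show ?case using Suc.prems by simp
qed simp

lemma C_bounded_Hoelder_deriv_I:
  assumes "bounded_Hoelder \<alpha> u" "\<And>x. (u has_real_derivative u' x) (at x)"
    "C_bounded_Hoelder \<alpha> j u'"
  shows "C_bounded_Hoelder \<alpha> (Suc j) u"
proof -
  have "deriv u = u'" using assms(2) by (auto intro: DERIV_imp_deriv)
  moreover have "u differentiable (at x)" for x
    using assms(2) real_differentiable_def by blast
  ultimately show ?thesis using assms by simp
qed

lemma C_bounded_Hoelder_deriv_E:
  assumes "C_bounded_Hoelder \<alpha> (Suc j) u"
  shows "(u has_real_derivative deriv u x) (at x)" "C_bounded_Hoelder \<alpha> j (deriv u)"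
  using assms by (auto simp: DERIV_deriv_iff_real_differentiable)

lemma real_differentiableI: "(f has_real_derivative D) (at x) \<Longrightarrow> f differentiable (at x)"
  using real_differentiable_def by blast

lemma bounded_Hoelder_add:
  assumes "bounded_Hoelder \<alpha> u" "bounded_Hoelder \<alpha> v"
  shows "bounded_Hoelder \<alpha> (\<lambda>x. u x + v x)"
proof -
  obtain A B where AB: "\<And>x. \<bar>u x\<bar> \<le> A" "\<And>x. \<bar>v x\<bar> \<le> B"
    using assms by (auto simp: bounded_Hoelder_def)
  have "\<bar>u x + v x\<bar> \<le> A + B" for x
    using AB[of x] by linarith
  moreover have "Hoelder_continuous \<alpha> (\<lambda>x. u x + v x)"
    if u: "Hoelder_continuous \<alpha> u" and v: "Hoelder_continuous \<alpha> v"
  proof -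
    obtain K where K: "\<And>x y. \<bar>u y - u x\<bar> \<le> K * \<bar>y - x\<bar> powr \<alpha>"
      using u unfolding Hoelder_continuous_def by blast
    obtain K' where K': "\<And>x y. \<bar>v y - v x\<bar> \<le> K' * \<bar>y - x\<bar> powr \<alpha>"
      using v unfolding Hoelder_continuous_def by blast
    have "\<bar>(u y + v y) - (u x + v x)\<bar> \<le> (K + K') * \<bar>y - x\<bar> powr \<alpha>" for x y
      using K[of y x] K'[of y x] unfolding distrib_right by linarith
    then show ?thesis unfolding Hoelder_continuous_def by blast
  qed
  ultimately show ?thesis
    using assms unfolding bounded_Hoelder_def by (auto intro!: continuous_intros)
qed

lemma bounded_Hoelder_mult:
  assumes "bounded_Hoelder \<alpha> u" "bounded_Hoelder \<alpha> v"
  shows "bounded_Hoelder \<alpha> (\<lambda>x. u x * v x)"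
proof -
  obtain A B where AB: "\<And>x. \<bar>u x\<bar> \<le> A" "\<And>x. \<bar>v x\<bar> \<le> B"
    using assms by (auto simp: bounded_Hoelder_def)
  then have nonneg: "0 \<le> A" "0 \<le> B"
    using abs_ge_zero order_trans by blast+
  have "\<bar>u x * v x\<bar> \<le> A * B" for x
    using AB[of x] nonneg by (auto simp: abs_mult intro!: mult_mono)
  moreover have "Hoelder_continuous \<alpha> (\<lambda>x. u x * v x)"
    if u: "Hoelder_continuous \<alpha> u" and v: "Hoelder_continuous \<alpha> v"
  proof -
    obtain K where K: "\<And>x y. \<bar>u y - u x\<bar> \<le> K * \<bar>y - x\<bar> powr \<alpha>"
      using u unfolding Hoelder_continuous_def by blast
    obtain K' where K': "\<And>x y. \<bar>v y - v x\<bar> \<le> K' * \<bar>y - x\<bar> powr \<alpha>"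
      using v unfolding Hoelder_continuous_def by blast
    have "\<bar>u y * v y - u x * v x\<bar> \<le> (A * K' + B * K) * \<bar>y - x\<bar> powr \<alpha>" for x y
    proof -
      have "u y * v y - u x * v x = u y * (v y - v x) + v x * (u y - u x)"
        by (simp add: algebra_simps)
      also have "\<bar>\<dots>\<bar> \<le> \<bar>u y\<bar> * \<bar>v y - v x\<bar> + \<bar>v x\<bar> * \<bar>u y - u x\<bar>"
        by (metis abs_mult abs_triangle_ineq)
      also have "\<dots> \<le> A * (K' * \<bar>y - x\<bar> powr \<alpha>) + B * (K * \<bar>y - x\<bar> powr \<alpha>)"
        using nonneg by (intro add_mono mult_mono AB K K') auto
      finally show ?thesis by (simp add: algebra_simps)
    qed
    then show ?thesis unfolding Hoelder_continuous_def by blast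
  qed
  ultimately show ?thesis
    using assms unfolding bounded_Hoelder_def by (auto intro!: continuous_intros)
qed

text \<open>A difference of reciprocals has denominator \<open>v y * v x\<close>, which is at least
  1, so the Hoelder constant of \<open>v\<close> is kept.\<close>

lemma bounded_Hoelder_inverse:
  assumes "bounded_Hoelder \<alpha> v" and ge: "\<And>x. 1 \<le> v x"
  shows "bounded_Hoelder \<alpha> (\<lambda>x. inverse (v x))"
proof -
  have ne: "v x \<noteq> 0" for x using ge[of x] by auto
  have "\<bar>inverse (v x)\<bar> \<le> 1" for x
    using ge[of x] by (simp add: inverse_le_1_iff)
  moreover have "Hoelder_continuous \<alpha> (\<lambda>x. inverse (v x))"
    if v: "Hoelder_continuous \<alpha> v"
  proof -
    obtain K where K: "\<And>x y. \<bar>v y - v x\<bar> \<le> K * \<bar>y - x\<bar> powr \<alpha>"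
      using v unfolding Hoelder_continuous_def by blast
    have "\<bar>inverse (v y) - inverse (v x)\<bar> \<le> K * \<bar>y - x\<bar> powr \<alpha>" for x y
    proof -
      have "inverse (v y) - inverse (v x) = (v x - v y) / (v y * v x)"
        using ne[of x] ne[of y] by (simp add: field_simps)
      also have "\<bar>\<dots>\<bar> \<le> \<bar>v x - v y\<bar> / 1"
        unfolding abs_divide
      proof (rule divide_left_mono)
        have "1 * 1 \<le> v y * v x"
          using ge[of x] ge[of y] by (intro mult_mono) auto
        then show "1 \<le> \<bar>v y * v x\<bar>" "0 < \<bar>v y * v x\<bar> * 1" by auto
      qed simp
      finally show ?thesis using K[of y x] by (simp add: abs_minus_commute)
    qed
    then show ?thesis unfolding Hoelder_continuous_def by blast
  qed
  ultimately show ?thesis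
    using assms(1) ne unfolding bounded_Hoelder_def by (auto intro!: continuous_intros)
qed

text \<open>The inner map will be the inverse of f, which is unbounded and so lies outside the
  class; being 1-Lipschitz, it preserves the Hoelder constant of \<open>u\<close>.\<close>

lemma bounded_Hoelder_compose:
  assumes "bounded_Hoelder \<alpha> u" and h: "\<And>x y. \<bar>h y - h x\<bar> \<le> \<bar>y - x :: real\<bar>"
  shows "bounded_Hoelder \<alpha> (\<lambda>x. u (h x))"
proof -
  have "1-lipschitz_on UNIV h"
    using h by (auto intro!: lipschitz_onI simp: dist_real_def)
  then have "continuous_on UNIV h" by (rule lipschitz_on_continuous_on)
  then have "continuous_on UNIV (\<lambda>x. u (h x))"
    using assms(1) by (auto simp: bounded_Hoelder_def intro: continuous_on_compose2)
  moreover have "Hoelder_continuous \<alpha> (\<lambda>x. u (h x))"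
    if \<alpha>: "0 < \<alpha>" and "Hoelder_continuous \<alpha> u"
  proof -
    from that(2) obtain K where K: "0 \<le> K" "\<And>x y. \<bar>u y - u x\<bar> \<le> K * \<bar>y - x\<bar> powr \<alpha>"
      by (rule Hoelder_continuous_nonnegE) blast
    have "\<bar>u (h y) - u (h x)\<bar> \<le> K * \<bar>y - x\<bar> powr \<alpha>" for x y
    proof -
      have "\<bar>u (h y) - u (h x)\<bar> \<le> K * \<bar>h y - h x\<bar> powr \<alpha>" by (rule K)
      also have "\<dots> \<le> K * \<bar>y - x\<bar> powr \<alpha>"
        using K(1) h \<alpha> by (intro mult_left_mono powr_mono2) auto
      finally show ?thesis .
    qed
    then show ?thesis unfolding Hoelder_continuous_def by blast
  qed
  ultimately show ?thesis
    using assms(1) unfolding bounded_Hoelder_def by blast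
qed

lemma C_bounded_Hoelder_add:
  assumes "C_bounded_Hoelder \<alpha> j u" "C_bounded_Hoelder \<alpha> j v"
  shows "C_bounded_Hoelder \<alpha> j (\<lambda>x. u x + v x)"
  using assms
proof (induction j arbitrary: u v)
  case 0
  then show ?case by (simp add: bounded_Hoelder_add)
next
  case (Suc j)
  note u = C_bounded_Hoelder_deriv_E[OF Suc.prems(1)] and v = C_bounded_Hoelder_deriv_E[OF Suc.prems(2)]
  show ?case
  proof (rule C_bounded_Hoelder_deriv_I)
    show "bounded_Hoelder \<alpha> (\<lambda>x. u x + v x)"
      using Suc.prems by (simp add: bounded_Hoelder_add)
    show "((\<lambda>x. u x + v x) has_real_derivative deriv u x + deriv v x) (at x)" for x
      by (intro DERIV_add u(1) v(1))
    show "C_bounded_Hoelder \<alpha> j (\<lambda>x. deriv u x + deriv v x)"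
      by (intro Suc.IH u(2) v(2))
  qed
qed

lemma C_bounded_Hoelder_mult:
  assumes "C_bounded_Hoelder \<alpha> j u" "C_bounded_Hoelder \<alpha> j v"
  shows "C_bounded_Hoelder \<alpha> j (\<lambda>x. u x * v x)"
  using assms
proof (induction j arbitrary: u v)
  case 0
  then show ?case by (simp add: bounded_Hoelder_mult)
next
  case (Suc j)
  note u = C_bounded_Hoelder_deriv_E[OF Suc.prems(1)] and v = C_bounded_Hoelder_deriv_E[OF Suc.prems(2)]
  show ?case
  proof (rule C_bounded_Hoelder_deriv_I)
    show "bounded_Hoelder \<alpha> (\<lambda>x. u x * v x)"
      using Suc.prems by (simp add: bounded_Hoelder_mult)
    show "((\<lambda>x. u x * v x) has_real_derivative deriv u x * v x + deriv v x * u x) (at x)" for x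
      by (intro DERIV_mult u(1) v(1))
    show "C_bounded_Hoelder \<alpha> j (\<lambda>x. deriv u x * v x + deriv v x * u x)"
      by (intro C_bounded_Hoelder_add Suc.IH u(2) v(2) Suc.prems[THEN C_bounded_Hoelder_Suc_imp])
  qed
qed

lemma C_bounded_Hoelder_const: "C_bounded_Hoelder \<alpha> j (\<lambda>x. c)"
proof (induction j arbitrary: c)
  have const: "bounded_Hoelder \<alpha> (\<lambda>x. c)" for c
    using exI[of _ "0::real"] by (auto simp: bounded_Hoelder_def Hoelder_continuous_def)
  {
    case 0
    then show ?case using const by simp
  next
    case (Suc j)
    show ?case by (rule C_bounded_Hoelder_deriv_I[OF const DERIV_const Suc.IH])
  }
qed

text \<open>The derivative of \<open>1 / v\<close> is a product of \<open>deriv v\<close> and two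
  copies of \<open>1 / v\<close>, all of which are known to order \<open>j\<close> when order
  \<open>Suc j\<close> is proved.\<close>

lemma C_bounded_Hoelder_inverse:
  assumes "C_bounded_Hoelder \<alpha> j v" and ge: "\<And>x. 1 \<le> v x"
  shows "C_bounded_Hoelder \<alpha> j (\<lambda>x. inverse (v x))"
  using assms(1)
proof (induction j)
  case 0
  then show ?case using ge by (simp add: bounded_Hoelder_inverse)
next
  case (Suc j)
  note v = C_bounded_Hoelder_deriv_E[OF Suc.prems]
  have IH: "C_bounded_Hoelder \<alpha> j (\<lambda>x. inverse (v x))"
    by (intro Suc.IH C_bounded_Hoelder_Suc_imp[OF Suc.prems])
  have ne: "v x \<noteq> 0" for x using ge[of x] by auto
  show ?case
  proof (rule C_bounded_Hoelder_deriv_I)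
    show "bounded_Hoelder \<alpha> (\<lambda>x. inverse (v x))"
      using Suc.prems ge by (simp add: bounded_Hoelder_inverse)
    show "((\<lambda>x. inverse (v x)) has_real_derivative
        - 1 * (inverse (v x) * deriv v x * inverse (v x))) (at x)" for x
      using DERIV_inverse'[OF v(1) ne] by simp
    show "C_bounded_Hoelder \<alpha> j (\<lambda>x. - 1 * (inverse (v x) * deriv v x * inverse (v x)))"
      by (intro C_bounded_Hoelder_mult C_bounded_Hoelder_const IH v(2))
  qed
qed

text \<open>Regularity is asked of \<open>h'\<close> only, and one order less than of
  \<open>u\<close>: this is what is available for an unbounded inverse function whose derivative is
  still being bootstrapped.\<close>

lemma C_bounded_Hoelder_compose:
  assumes "C_bounded_Hoelder \<alpha> (Suc j) u"
    and h: "\<And>x y. \<bar>h y - h x\<bar> \<le> \<bar>y - x :: real\<bar>"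
    and h': "\<And>x. (h has_real_derivative h' x) (at x)" "C_bounded_Hoelder \<alpha> j h'"
  shows "C_bounded_Hoelder \<alpha> (Suc j) (\<lambda>x. u (h x))"
  using assms(1) h'(2)
proof (induction j arbitrary: u)
  case 0
  note u = C_bounded_Hoelder_deriv_E[OF 0(1)]
  show ?case
  proof (rule C_bounded_Hoelder_deriv_I)
    show "bounded_Hoelder \<alpha> (\<lambda>x. u (h x))"
      using 0 h by (simp add: bounded_Hoelder_compose)
    show "((\<lambda>x. u (h x)) has_real_derivative deriv u (h x) * h' x) (at x)" for x
      by (rule DERIV_chain2[OF u(1) h'(1)])
    show "C_bounded_Hoelder \<alpha> 0 (\<lambda>x. deriv u (h x) * h' x)"
      using u(2) 0 h by (simp add: bounded_Hoelder_mult bounded_Hoelder_compose)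
  qed
next
  case (Suc j)
  note u = C_bounded_Hoelder_deriv_E[OF Suc.prems(1)]
  show ?case
  proof (rule C_bounded_Hoelder_deriv_I)
    show "bounded_Hoelder \<alpha> (\<lambda>x. u (h x))"
      using C_bounded_Hoelder_imp_bounded_Hoelder[OF Suc.prems(1)] h
      by (simp add: bounded_Hoelder_compose)
    show "((\<lambda>x. u (h x)) has_real_derivative deriv u (h x) * h' x) (at x)" for x
      by (rule DERIV_chain2[OF u(1) h'(1)])
    show "C_bounded_Hoelder \<alpha> (Suc j) (\<lambda>x. deriv u (h x) * h' x)"
      by (intro C_bounded_Hoelder_mult Suc.IH u(2) C_bounded_Hoelder_Suc_imp[OF Suc.prems(2)]
          Suc.prems(2))
  qed
qed

section \<open>Functions with derivative at least 1 are diffeomorphisms\<close>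

lemma C_k_Suc_I:
  assumes "\<And>x. f differentiable (at x)" "C_k k (deriv f)"
  shows "C_k (Suc k) f"
proof -
  have "(deriv ^^ i) f differentiable (at x)" if "i < Suc k" for i x
  proof (cases i)
    case 0
    then show ?thesis using assms(1) by simp
  next
    case (Suc i')
    then have "(deriv ^^ i) f = (deriv ^^ i') (deriv f)"
      by (simp add: funpow_Suc_right del: funpow.simps)
    then show ?thesis using assms(2) that Suc by (simp add: C_k_def)
  qed
  moreover have "continuous_on UNIV ((deriv ^^ Suc k) f)"
    using assms(2) by (simp add: C_k_def funpow_Suc_right del: funpow.simps)
  ultimately show ?thesis by (simp add: C_k_def)
qed

lemma C_bounded_Hoelder_imp_C_k:
  "C_bounded_Hoelder \<alpha> j u \<Longrightarrow> C_k j u"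
proof (induction j arbitrary: u)
  case 0
  then show ?case by (simp add: C_k_def bounded_Hoelder_def)
next
  case (Suc j)
  then show ?case by (auto intro: C_k_Suc_I)
qed

lemma C_bounded_Hoelder_imp_Hoelder:
  "C_bounded_Hoelder \<alpha> j u \<Longrightarrow> 0 < \<alpha> \<Longrightarrow> Hoelder_continuous \<alpha> ((deriv ^^ j) u)"
proof (induction j arbitrary: u)
  case 0
  then show ?case by (simp add: bounded_Hoelder_def)
next
  case (Suc j)
  then show ?case by (simp add: funpow_Suc_right del: funpow.simps)
qed

text \<open>With \<open>h = inv f\<close> one has \<open>h' = inverse (f' \<circ> h)\<close>, so the regularity of \<open>h'\<close> is bootstrapped one
  derivative at a time.\<close>

lemma diffeomorphism_if_deriv_ge_1:
  assumes f: "\<And>x. (f has_real_derivative f' x) (at x)" and ge: "\<And>x. 1 \<le> f' x"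
    and f': "C_bounded_Hoelder \<alpha> j f'"
  shows "diffeomorphism (Suc j) \<alpha> f"
proof -
  \<comment> \<open>The mean value theorem makes \<open>f\<close> expand distances, which yields
    injectivity, surjectivity and the Lipschitz constant 1 of the inverse.\<close>
  have expand: "y - x \<le> f y - f x" if "x \<le> y" for x y
  proof (cases "x = y")
    case False
    then have "x < y" using that by simp
    then obtain z where "f y - f x = (y - x) * f' z"
      using MVT2[of x y f f'] f by blast
    moreover have "(y - x) * 1 \<le> (y - x) * f' z"
      using that ge by (intro mult_left_mono) auto
    ultimately show ?thesis by simp
  qed simp
  have "inj f"
  proof (rule injI)
    fix x y
    assume "f x = f y"
    then show "x = y"
      using expand[of x y] expand[of y x] by linarith
  qed
  have cont: "continuous_on A f" for A
    using f by (meson DERIV_isCont continuous_at_imp_continuous_on)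
  have "surj f"
  proof (rule surjI)
    fix y
    \<comment> \<open>By expansion,
      \<open>f (- R) \<le> f 0 - R \<le> y \<le> f 0 + R \<le> f R\<close>.\<close>
    define R where "R = \<bar>y - f 0\<bar>"
    have "f (- R) \<le> y" "y \<le> f R"
      using expand[of "- R" 0] expand[of 0 R] by (auto simp: R_def)
    moreover have "- R \<le> R" by (simp add: R_def)
    ultimately have "\<exists>x. f x = y"
      using IVT'[of f "- R" y R] cont by blast
    then show "f (SOME x. f x = y) = y" by (rule someI_ex)
  qed
  with \<open>inj f\<close> have "bij f" by (simp add: bij_def)
  define h where "h = inv f"
  have fh: "f (h y) = y" for y
    using \<open>surj f\<close> by (simp add: h_def surj_f_inv_f)
  have h_lip: "\<bar>h y - h x\<bar> \<le> \<bar>y - x\<bar>" for x y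
    using expand[of "h x" "h y"] expand[of "h y" "h x"] unfolding fh by linarith
  have h_cont: "isCont h y" for y
  proof -
    have "1-lipschitz_on UNIV h"
      using h_lip by (auto intro!: lipschitz_onI simp: dist_real_def)
    then show ?thesis
      by (metis UNIV_I continuous_on_eq_continuous_at lipschitz_on_continuous_on open_UNIV)
  qed
  have h': "(h has_real_derivative inverse (f' (h y))) (at y)" for y
  proof (rule DERIV_inverse_function[where a = "y - 1" and b = "y + 1"])
    show "f' (h y) \<noteq> 0" using ge[of "h y"] by auto
  qed (use f fh h_cont in auto)
  have reg: "C_bounded_Hoelder \<alpha> i (\<lambda>y. inverse (f' (h y)))" if "i \<le> j" for i
    using that
  proof (induction i)
    case 0
    then show ?case
      using C_bounded_Hoelder_imp_bounded_Hoelder[OF f'] h_lip ge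
      by (simp add: bounded_Hoelder_inverse bounded_Hoelder_compose)
  next
    case (Suc i)
    have "C_bounded_Hoelder \<alpha> (Suc i) f'"
      using \<open>Suc i \<le> j\<close> f'
    proof (induction rule: inc_induct)
      case (step n)
      then show ?case using C_bounded_Hoelder_Suc_imp by blast
    qed
    \<comment> \<open>Order \<open>i\<close> of h' lets the chain rule reach order
      \<open>Suc i\<close> for \<open>f' (h y)\<close>, and the reciprocal of this function is h'
      again.\<close>
    then have "C_bounded_Hoelder \<alpha> (Suc i) (\<lambda>y. f' (h y))"
      using Suc by (intro C_bounded_Hoelder_compose[OF _ h_lip h']) auto
    then show ?case using ge by (intro C_bounded_Hoelder_inverse) auto
  qed
  have df: "deriv f = f'" and dh: "deriv h = (\<lambda>y. inverse (f' (h y)))"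
    using f h' by (auto intro: DERIV_imp_deriv)
  have "C_k (Suc j) f" "C_k (Suc j) h"
    using C_bounded_Hoelder_imp_C_k[OF f'] C_bounded_Hoelder_imp_C_k[OF reg[of j]]
      real_differentiableI[OF f] real_differentiableI[OF h']
    by (auto intro!: C_k_Suc_I simp: df dh)
  moreover have "Hoelder_continuous \<alpha> ((deriv ^^ Suc j) f)"
    "Hoelder_continuous \<alpha> ((deriv ^^ Suc j) h)" if "0 < \<alpha>"
    using C_bounded_Hoelder_imp_Hoelder[OF f' that] C_bounded_Hoelder_imp_Hoelder[OF reg[of j] that]
    unfolding funpow_Suc_right o_apply df dh by auto
  ultimately show ?thesis
    using \<open>bij f\<close> by (simp add: diffeomorphism_def h_def)
qed

section \<open>Vanishing of the derivatives of the bump profile\<close>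

text \<open>Meant for the points 0 and 1, where the profile is known to be constant on one side
  only: the zero set of a continuous derivative is closed.\<close>

lemma deriv_zero_on_closure:
  fixes g :: "real \<Rightarrow> real"
  assumes "open S" "continuous_on UNIV (deriv g)" "\<And>x. x \<in> S \<Longrightarrow> g x = c" "x \<in> closure S"
  shows "deriv g x = 0"
proof -
  have "deriv g y = 0" if "y \<in> S" for y
  proof -
    have "(g has_real_derivative 0) (at y)"
      by (rule has_field_derivative_transform_within_open[OF DERIV_const[of c] \<open>open S\<close> that])
        (use assms(3) in auto)
    then show ?thesis by (rule DERIV_imp_deriv)
  qed
  then have "S \<subseteq> {y. deriv g y = 0}" by blast
  moreover have "closed {y. deriv g y = 0}"
    using assms(2) by (intro closed_Collect_eq) auto
  ultimately have "closure S \<subseteq> {y. deriv g y = 0}"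
    by (rule closure_minimal)
  then show ?thesis using assms(4) by blast
qed

lemma C_infinity_higher_deriv:
  assumes "C_infinity \<phi>"
  shows "((deriv ^^ k) \<phi> has_real_derivative (deriv ^^ Suc k) \<phi> x) (at x)"
    and "continuous_on UNIV ((deriv ^^ k) \<phi>)"
proof -
  have "C_k (Suc k) \<phi>" using assms by (simp add: C_infinity_def)
  then have "(deriv ^^ k) \<phi> differentiable (at x)" by (simp add: C_k_def)
  then show "((deriv ^^ k) \<phi> has_real_derivative (deriv ^^ Suc k) \<phi> x) (at x)"
    by (simp add: DERIV_deriv_iff_real_differentiable)
  have "C_k k \<phi>" using assms by (simp add: C_infinity_def)
  then show "continuous_on UNIV ((deriv ^^ k) \<phi>)" by (simp add: C_k_def)
qed

text \<open>From the second derivative on, the function being differentiated has the constant value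
  0 on \<open>S\<close> instead of \<open>c\<close>.\<close>

lemma higher_deriv_zero:
  fixes \<phi> :: "real \<Rightarrow> real"
  assumes smooth: "C_infinity \<phi>" and "open S" "\<And>x. x \<in> S \<Longrightarrow> \<phi> x = c"
    and "1 \<le> k" "x \<in> closure S"
  shows "(deriv ^^ k) \<phi> x = 0"
  using assms(4,5)
proof (induction k arbitrary: x rule: nat_induct_at_least)
  case base
  have "continuous_on UNIV (deriv \<phi>)"
    using C_infinity_higher_deriv(2)[OF smooth, of 1] by simp
  then show ?case
    using deriv_zero_on_closure[of S \<phi> c x] assms base by simp
next
  case (Suc k)
  have "continuous_on UNIV (deriv ((deriv ^^ k) \<phi>))"
    using C_infinity_higher_deriv(2)[OF smooth, of "Suc k"] by simp
  moreover have "(deriv ^^ k) \<phi> y = 0" if "y \<in> S" for y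
    using Suc.IH that closure_subset by blast
  ultimately show ?case
    using deriv_zero_on_closure[of S "(deriv ^^ k) \<phi>" 0 x] \<open>open S\<close> Suc.prems by simp
qed

section \<open>Bounded gaps of a compact set\<close>

text \<open>A point of a gap beyond a bound of \<open>E\<close> would bring a whole ray of the
  complement into its component, which would then be unbounded.\<close>

lemma bounded_gaps_subset_Icc:
  fixes E :: "real set"
  assumes "compact E"
  obtains R where "\<And>U. U \<in> bounded_gaps E \<Longrightarrow> U \<subseteq> {-R..R}"
proof -
  obtain R where R: "\<And>x. x \<in> E \<Longrightarrow> \<bar>x\<bar> \<le> R"
    using compact_imp_bounded[OF assms] by (auto simp: bounded_real)
  have "U \<subseteq> {-R..R}" if U: "U \<in> bounded_gaps E" for U
  proof
    fix x
    assume x: "x \<in> U"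
    have comp: "U \<in> components (- E)" and bdd: "bounded U"
      using U by (auto simp: bounded_gaps_def)
    have max: "C \<subseteq> U" if "connected C" "C \<subseteq> - E" "x \<in> C" for C
      using components_maximal[OF comp that(1,2)] x that(3) by blast
    have "x \<le> R"
    proof (rule ccontr)
      assume "\<not> x \<le> R"
      then have "{x..} \<subseteq> - E"
        using R by fastforce
      then have "{x..} \<subseteq> U" by (intro max) auto
      then have "bounded {x..}" using bdd bounded_subset by blast
      then obtain b where b: "\<And>y. x \<le> y \<Longrightarrow> \<bar>y\<bar> \<le> b" by (auto simp: bounded_real)
      have "\<bar>\<bar>x\<bar> + \<bar>b\<bar> + 1\<bar> \<le> b" by (rule b) simp
      then show False by simp
    qed
    moreover have "- R \<le> x"
    proof (rule ccontr)
      assume "\<not> - R \<le> x"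
      then have "{..x} \<subseteq> - E"
        using R by fastforce
      then have "{..x} \<subseteq> U" by (intro max) auto
      then have "bounded {..x}" using bdd bounded_subset by blast
      then obtain b where b: "\<And>y. y \<le> x \<Longrightarrow> \<bar>y\<bar> \<le> b" by (auto simp: bounded_real)
      have "\<bar>- \<bar>x\<bar> - \<bar>b\<bar> - 1\<bar> \<le> b" by (rule b) simp
      then show False by simp
    qed
    ultimately show "x \<in> {-R..R}" by simp
  qed
  then show ?thesis by (rule that)
qed

text \<open>Openness keeps supremum and infimum out of the set; connectedness fills in everything
  between.\<close>

lemma bounded_open_connected_eq_Ioo:
  fixes U :: "real set"
  assumes "open U" "connected U" "bounded U" "U \<noteq> {}"
  shows "U = {Inf U<..<Sup U}"
proof -
  have bdd: "bdd_above U" "bdd_below U"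
    using \<open>bounded U\<close> by (auto simp: bounded_imp_bdd_above bounded_imp_bdd_below)
  have "Inf U < x \<and> x < Sup U" if x: "x \<in> U" for x
  proof -
    obtain b where "x < b" "{x..<b} \<subseteq> U"
      using open_right[OF \<open>open U\<close> x, of "x + 1"] by auto
    then have "(x + b) / 2 \<in> U" "x < (x + b) / 2" by (auto simp: subset_iff)
    then have "x < Sup U" using bdd by (meson cSup_upper less_le_trans)
    moreover obtain a where "a < x" "{a<..x} \<subseteq> U"
      using open_left[OF \<open>open U\<close> x, of "x - 1"] by auto
    then have "(x + a) / 2 \<in> U" "(x + a) / 2 < x" by (auto simp: subset_iff)
    then have "Inf U < x" using bdd by (meson cInf_lower le_less_trans)
    ultimately show ?thesis by simp
  qed
  moreover have "x \<in> U" if "Inf U < x" "x < Sup U" for x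
  proof -
    obtain a b where "a \<in> U" "a < x" "b \<in> U" "x < b"
      using \<open>Inf U < x\<close> \<open>x < Sup U\<close> bdd \<open>U \<noteq> {}\<close> by (meson cInf_less_iff less_cSup_iff)
    then show ?thesis
      using \<open>connected U\<close> connected_contains_Icc[of U a b] by auto
  qed
  ultimately show ?thesis by auto
qed

lemma bounded_gap_eq_Ioo:
  assumes "closed E" "U \<in> bounded_gaps E"
  shows "U = {Inf U<..<Sup U}" "0 < gap_length U"
proof -
  have comp: "U \<in> components (- E)" and bdd: "bounded U"
    using assms by (auto simp: bounded_gaps_def)
  have "open U"
    using open_components[OF _ comp] \<open>closed E\<close> by (simp add: open_Compl)
  then show eq: "U = {Inf U<..<Sup U}"
    using bounded_open_connected_eq_Ioo in_components_connected[OF comp]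
      in_components_nonempty[OF comp] bdd by blast
  show "0 < gap_length U"
    using in_components_nonempty[OF comp] eq
    by (metis diff_gt_0_iff_gt gap_length_def greaterThanLessThan_empty_iff not_le)
qed

lemma bounded_gaps_disjoint:
  assumes "U \<in> bounded_gaps E" "V \<in> bounded_gaps E" "x \<in> U" "x \<in> V"
  shows "U = V"
  using assms components_nonoverlap[of U "- E" V] by (auto simp: bounded_gaps_def)

text \<open>Finitely many gaps are disjoint intervals in \<open>{-R..R}\<close>, so their total
  length is at most the Lebesgue measure of that interval.\<close>

lemma gap_length_summable:
  assumes "compact E"
  shows "gap_length summable_on bounded_gaps E"
proof (rule nonneg_bdd_above_summable_on)
  have "closed E" using assms by (rule compact_imp_closed)
  note gap = bounded_gap_eq_Ioo[OF this]
  show "0 \<le> gap_length U" if "U \<in> bounded_gaps E" for U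
    using gap(2)[OF that] by simp
  obtain R where R: "\<And>U. U \<in> bounded_gaps E \<Longrightarrow> U \<subseteq> {-R..R}"
    using bounded_gaps_subset_Icc[OF assms] by blast
  have "sum gap_length F \<le> measure lborel {-R..R}"
    if F: "finite F" "F \<subseteq> bounded_gaps E" for F
  proof -
    have emeas: "emeasure lborel {-R..R} < \<infinity>"
      by (simp add: emeasure_lborel_Icc_eq)
    have meas: "U \<in> sets lborel" "measure lborel U = gap_length U" "emeasure lborel U \<noteq> \<infinity>"
      if "U \<in> F" for U
    proof -
      have U: "U \<in> bounded_gaps E" using that F by blast
      have "U = {Inf U<..<Sup U}" "Inf U \<le> Sup U"
        using gap[OF U] by (auto simp: gap_length_def)
      then show "U \<in> sets lborel" "measure lborel U = gap_length U" "emeasure lborel U \<noteq> \<infinity>"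
        by (metis borel_open open_greaterThanLessThan sets_lborel,
          metis measure_lborel_Ioo gap_length_def,
          metis emeasure_lborel_Ioo ennreal_neq_top infinity_ennreal_def)
    qed
    have "sum gap_length F = (\<Sum>U\<in>F. measure lborel U)"
      using meas by simp
    also have "\<dots> = measure lborel (\<Union>U\<in>F. U)"
    proof (rule measure_finite_Union[symmetric])
      show "disjoint_family_on (\<lambda>U. U) F"
        using F bounded_gaps_disjoint unfolding disjoint_family_on_def by blast
    qed (use F meas in auto)
    also have "\<dots> \<le> measure lborel {-R..R}"
    proof (intro measure_mono_fmeasurable fmeasurableI)
      show "(\<Union>U\<in>F. U) \<subseteq> {-R..R}" using F R by blast
      show "(\<Union>U\<in>F. U) \<in> sets lborel" using F(1) meas(1) by blast
    qed (use emeas in auto)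
    finally show ?thesis .
  qed
  then show "bdd_above (sum gap_length ` {F. F \<subseteq> bounded_gaps E \<and> finite F})"
    by (intro bdd_aboveI[where M = "measure lborel {-R..R}"]) auto
qed

section \<open>Termwise differentiation of unordered sums\<close>

text \<open>No uniform convergence is required: the mean value theorem turns equicontinuity of the
  differentiated partial sums into a bound on difference quotients that survives pointwise limits.\<close>

lemma has_real_derivative_has_sum:
  fixes T T' :: "'a \<Rightarrow> real \<Rightarrow> real"
  assumes deriv: "\<And>U x. U \<in> D \<Longrightarrow> (T U has_real_derivative T' U x) (at x)"
    and sums: "\<And>x. ((\<lambda>U. T U x) has_sum G x) D" "\<And>x. ((\<lambda>U. T' U x) has_sum G' x) D"
    and equi: "\<And>F x y. finite F \<Longrightarrow> F \<subseteq> D \<Longrightarrow>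
      \<bar>(\<Sum>U\<in>F. T' U y) - (\<Sum>U\<in>F. T' U x)\<bar> \<le> w \<bar>y - x\<bar>"
    and w: "(w \<longlongrightarrow> 0) (at_right 0)" "\<And>s t. 0 \<le> s \<Longrightarrow> s \<le> t \<Longrightarrow> w s \<le> w t"
  shows "(G has_real_derivative G' x) (at x)"
proof -
  \<comment> \<open>The remainder estimate is the same for all \<open>F\<close>, which is what
    allows the passage to the limit for fixed \<open>y\<close>.\<close>
  have finite_bound: "\<bar>(\<Sum>U\<in>F. T U y) - (\<Sum>U\<in>F. T U x) - (y - x) * (\<Sum>U\<in>F. T' U x)\<bar>
      \<le> \<bar>y - x\<bar> * w \<bar>y - x\<bar>" if F: "finite F" "F \<subseteq> D" and "y \<noteq> x" for F y
  proof -
    define S S' where "S = (\<lambda>z. \<Sum>U\<in>F. T U z)" and "S' = (\<lambda>z. \<Sum>U\<in>F. T' U z)"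
    have S: "(S has_real_derivative S' z) (at z)" for z
      unfolding S_def S'_def using F deriv by (intro DERIV_sum) auto
    obtain z where z: "S y - S x = (y - x) * S' z" "\<bar>z - x\<bar> \<le> \<bar>y - x\<bar>"
    proof (cases "x < y")
      case True
      then show ?thesis
        using MVT2[of x y S S'] S that by force
    next
      case False
      then obtain z where "y < z" "z < x" "S x - S y = (x - y) * S' z"
        using MVT2[of y x S S'] S \<open>y \<noteq> x\<close> by force
      then show ?thesis
        by (intro that[of z]) (auto simp: algebra_simps)
    qed
    have "S y - S x - (y - x) * S' x = (y - x) * (S' z - S' x)"
      using z by (simp add: algebra_simps)
    then have "\<bar>S y - S x - (y - x) * S' x\<bar> = \<bar>y - x\<bar> * \<bar>S' z - S' x\<bar>"
      by (simp add: abs_mult)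
    also have "\<bar>S' z - S' x\<bar> \<le> w \<bar>z - x\<bar>"
      unfolding S'_def by (rule equi[OF F])
    also have "w \<bar>z - x\<bar> \<le> w \<bar>y - x\<bar>"
      using z by (intro w) auto
    finally show ?thesis by (simp add: S_def S'_def mult_left_mono)
  qed
  have bound: "\<bar>G y - G x - (y - x) * G' x\<bar> \<le> \<bar>y - x\<bar> * w \<bar>y - x\<bar>" if "y \<noteq> x" for y
  proof (rule tendsto_upperbound)
    show "((\<lambda>F. \<bar>(\<Sum>U\<in>F. T U y) - (\<Sum>U\<in>F. T U x) - (y - x) * (\<Sum>U\<in>F. T' U x)\<bar>)
        \<longlongrightarrow> \<bar>G y - G x - (y - x) * G' x\<bar>) (finite_subsets_at_top D)"
      using sums unfolding has_sum_def by (intro tendsto_intros) auto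
    show "\<forall>\<^sub>F F in finite_subsets_at_top D.
        \<bar>(\<Sum>U\<in>F. T U y) - (\<Sum>U\<in>F. T U x) - (y - x) * (\<Sum>U\<in>F. T' U x)\<bar>
          \<le> \<bar>y - x\<bar> * w \<bar>y - x\<bar>"
      using finite_bound that by (intro eventually_finite_subsets_at_top_weakI) auto
  qed simp
  have "((\<lambda>y. (G y - G x) / (y - x)) \<longlongrightarrow> G' x) (at x)"
  proof (rule LIM_zero_cancel, rule Lim_null_comparison)
    show "\<forall>\<^sub>F y in at x. norm ((G y - G x) / (y - x) - G' x) \<le> w \<bar>y - x\<bar>"
    proof (rule eventually_mono[OF eventually_neq_at_within])
      fix y
      assume "y \<noteq> x"
      then have "(G y - G x) / (y - x) - G' x = (G y - G x - (y - x) * G' x) / (y - x)"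
        by (simp add: field_simps)
      then show "norm ((G y - G x) / (y - x) - G' x) \<le> w \<bar>y - x\<bar>"
        using bound[OF \<open>y \<noteq> x\<close>] \<open>y \<noteq> x\<close> by (simp add: abs_divide divide_le_eq mult.commute)
    qed
    show "((\<lambda>y. w \<bar>y - x\<bar>) \<longlongrightarrow> 0) (at x)"
      using filterlim_compose[OF w(1) tendsto_abs_diff_at_right_0] .
  qed
  then show ?thesis by (simp add: has_field_derivative_iff)
qed

section \<open>The summands for a fixed parameter\<close>

text \<open>The parameter is fixed; uniformity in \<open>\<omega>\<close> shows in the final
  constant, which does not mention it.\<close>

locale gap_family =
  fixes E :: "real set" and m :: nat and \<alpha> :: real and \<phi> :: "real \<Rightarrow> real"
    and \<omega> :: "real set \<Rightarrow> real"
  assumes compact_E: "compact E" and m_ge_1: "1 \<le> m" and \<alpha>: "0 \<le> \<alpha>" "\<alpha> \<le> 1"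
    and mono_\<phi>: "mono \<phi>" and smooth: "C_infinity \<phi>"
    and \<phi>_left: "\<And>x. x \<le> 0 \<Longrightarrow> \<phi> x = 0" and \<phi>_right: "\<And>x. x \<ge> 1 \<Longrightarrow> \<phi> x = 1"
    and \<omega>: "\<omega> \<in> parameters E m \<alpha>"
begin

abbreviation D :: "real set set" where "D \<equiv> bounded_gaps E"

abbreviation \<psi> :: "nat \<Rightarrow> real \<Rightarrow> real" where "\<psi> k \<equiv> (deriv ^^ k) \<phi>"

text \<open>This is the \<open>k\<close>-th derivative of the summand of \<open>U\<close>, each
  differentiation contributing a factor \<open>1 / gap_length U\<close>.\<close>

definition gap_term :: "nat \<Rightarrow> real set \<Rightarrow> real \<Rightarrow> real" where
  "gap_term k U x = \<omega> U / gap_length U ^ k * \<psi> k ((x - Inf U) / gap_length U)"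

definition gap_sum :: "nat \<Rightarrow> real \<Rightarrow> real" where
  "gap_sum k x = (\<Sum>\<^sub>\<infinity>U\<in>D. gap_term k U x)"

lemmas gap = bounded_gap_eq_Ioo[OF compact_imp_closed[OF compact_E]]

lemma gap_mem_iff:
  assumes "U \<in> D"
  shows "x \<in> U \<longleftrightarrow> Inf U < x \<and> x < Sup U"
proof -
  have "x \<in> U \<longleftrightarrow> x \<in> {Inf U<..<Sup U}" by (rule arg_cong[OF gap(1)[OF assms]])
  then show ?thesis by simp
qed

lemma \<psi>_zero:
  assumes "1 \<le> k" "t \<le> 0 \<or> 1 \<le> t"
  shows "\<psi> k t = 0"
  using assms(2)
proof
  assume "t \<le> 0"
  then show ?thesis
    using \<phi>_left by (intro higher_deriv_zero[OF smooth, of "{..<0}" 0] assms(1)) simp_all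
next
  assume "1 \<le> t"
  then show ?thesis
    using \<phi>_right by (intro higher_deriv_zero[OF smooth, of "{1<..}" 1] assms(1)) simp_all
qed

text \<open>The supremum is meaningful because \<open>\<psi> k\<close> is continuous on the compact
  unit interval and vanishes outside it.\<close>

lemma \<psi>_le_sup_norm:
  assumes "1 \<le> k"
  shows "\<bar>\<psi> k t\<bar> \<le> sup_norm (\<psi> k)"
proof -
  have "compact (\<psi> k ` {0..1})"
    using continuous_on_subset[OF C_infinity_higher_deriv(2)[OF smooth]] compact_Icc
    by (intro compact_continuous_image) auto
  then obtain B where B: "\<And>s. s \<in> {0..1} \<Longrightarrow> \<bar>\<psi> k s\<bar> \<le> B"
    using compact_imp_bounded by (fastforce simp: bounded_real)
  have "\<bar>\<psi> k s\<bar> \<le> max B 0" for s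
    using B[of s] \<psi>_zero[OF assms, of s] by (cases "s \<in> {0..1}") auto
  then have "bdd_above (range (\<lambda>s. \<bar>\<psi> k s\<bar>))" by (intro bdd_aboveI) auto
  then show ?thesis unfolding sup_norm_def by (rule cSUP_upper[rotated]) simp
qed

lemma sup_norm_\<psi>_nonneg: "1 \<le> k \<Longrightarrow> 0 \<le> sup_norm (\<psi> k)"
  using \<psi>_le_sup_norm[of k 0] abs_ge_zero order_trans by blast

text \<open>At \<open>k = m\<close> this brings in the norm of the derivative of order m + 1 of the
  profile.\<close>

lemma \<psi>_lipschitz: "\<bar>\<psi> k t - \<psi> k s\<bar> \<le> sup_norm (\<psi> (Suc k)) * \<bar>t - s\<bar>"
proof -
  have "norm (\<psi> k t - \<psi> k s) \<le> sup_norm (\<psi> (Suc k)) * norm (t - s)"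
  proof (rule field_differentiable_bound)
    show "(\<psi> k has_field_derivative \<psi> (Suc k) z) (at z within UNIV)" for z
      by (rule C_infinity_higher_deriv(1)[OF smooth])
    show "norm (\<psi> (Suc k) z) \<le> sup_norm (\<psi> (Suc k))" for z
      unfolding real_norm_def by (rule \<psi>_le_sup_norm) simp
  qed (rule convex_UNIV UNIV_I)+
  then show ?thesis by (simp only: real_norm_def)
qed

lemma gap_length_bounded:
  obtains B where "0 \<le> B" "\<And>U. U \<in> D \<Longrightarrow> gap_length U \<le> B"
proof -
  obtain R where R: "\<And>U. U \<in> D \<Longrightarrow> U \<subseteq> {-R..R}"
    using bounded_gaps_subset_Icc[OF compact_E] by blast
  have "gap_length U \<le> 2 * \<bar>R\<bar>" if U: "U \<in> D" for U
  proof -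
    have "{Inf U<..<Sup U} \<subseteq> {-R..R}" "Inf U < Sup U"
      using R[OF U] gap[OF U] by (auto simp: gap_length_def)
    then have "- R \<le> Inf U" "Sup U \<le> R"
      using closure_minimal[of "{Inf U<..<Sup U}" "{-R..R}"] by auto
    then show ?thesis by (simp add: gap_length_def)
  qed
  then show ?thesis by (intro that[of "2 * \<bar>R\<bar>"]) auto
qed

lemma \<omega>_bounds:
  assumes "U \<in> D"
  shows "0 \<le> \<omega> U" "\<omega> U \<le> gap_length U ^ m * modulus \<alpha> (gap_length U)"
proof -
  have "\<omega> U \<in> {0..gap_bound m \<alpha> U}"
    using \<omega> assms unfolding parameters_def by (rule PiE_mem)
  then show "0 \<le> \<omega> U" "\<omega> U \<le> gap_length U ^ m * modulus \<alpha> (gap_length U)"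
    by (simp_all add: gap_bound_def)
qed

section \<open>Amplitudes and oscillation of the terms\<close>

text \<open>The constant lets one set of estimates serve both order \<open>m\<close>, where
  \<open>C = 1\<close> gives the sharp claim, and lower orders, where any finite \<open>C\<close>
  will do.\<close>

definition coeff_bound :: "nat \<Rightarrow> real \<Rightarrow> bool" where
  "coeff_bound k C \<longleftrightarrow> 0 \<le> C \<and>
     (\<forall>U\<in>D. \<omega> U / gap_length U ^ k \<le> C * modulus \<alpha> (gap_length U))"

lemma coeff_bound_m: "coeff_bound m 1"
proof -
  have "\<omega> U / gap_length U ^ m \<le> modulus \<alpha> (gap_length U)" if "U \<in> D" for U
    using \<omega>_bounds(2)[OF that] gap(2)[OF that] by (simp add: pos_divide_le_eq mult.commute)
  then show ?thesis by (simp add: coeff_bound_def)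
qed

text \<open>Below order \<open>m\<close> a factor \<open>gap_length U ^ (m - k)\<close> is left
  over; it is bounded because the gaps lie in a bounded interval.\<close>

lemma coeff_bound_exists:
  assumes "k \<le> m"
  obtains C where "coeff_bound k C"
proof -
  obtain B where B: "0 \<le> B" "\<And>U. U \<in> D \<Longrightarrow> gap_length U \<le> B"
    using gap_length_bounded by blast
  have "\<omega> U / gap_length U ^ k \<le> B ^ (m - k) * modulus \<alpha> (gap_length U)" if U: "U \<in> D" for U
  proof -
    have pos: "0 < gap_length U" by (rule gap(2)[OF U])
    have "\<omega> U / gap_length U ^ k \<le> gap_length U ^ m * modulus \<alpha> (gap_length U) / gap_length U ^ k"
      using \<omega>_bounds(2)[OF U] pos by (simp add: divide_right_mono)
    also have "\<dots> = gap_length U ^ (m - k) * modulus \<alpha> (gap_length U)"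
      using pos assms by (simp add: power_diff)
    also have "\<dots> \<le> B ^ (m - k) * modulus \<alpha> (gap_length U)"
      using B(2)[OF U] pos by (intro mult_right_mono power_mono modulus_nonneg) auto
    finally show ?thesis .
  qed
  then have "coeff_bound k (B ^ (m - k))" using B by (auto simp: coeff_bound_def)
  then show ?thesis by (rule that)
qed

text \<open>The summand itself, \<open>k = 0\<close>, is excluded: to the right of \<open>U\<close>
  it has the value \<open>\<omega> U\<close>.\<close>

lemma gap_term_outside:
  assumes "U \<in> D" "1 \<le> k" "x \<notin> U"
  shows "gap_term k U x = 0"
proof -
  have "(x - Inf U) / gap_length U \<le> 0 \<or> 1 \<le> (x - Inf U) / gap_length U"
    using assms gap(2)[of U] gap_mem_iff[of U x]
    by (auto simp: divide_le_0_iff le_divide_eq gap_length_def)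
  then show ?thesis using \<psi>_zero assms(2) by (simp add: gap_term_def)
qed

lemma abs_gap_term_diff_le:
  assumes "U \<in> D"
  shows "\<bar>gap_term k U y - gap_term k U x\<bar> \<le>
    \<omega> U / gap_length U ^ k * sup_norm (\<psi> (Suc k)) * (\<bar>y - x\<bar> / gap_length U)"
proof -
  define p where "p = gap_length U"
  have p: "0 < p" using gap(2)[OF assms] by (simp add: p_def)
  have "gap_term k U y - gap_term k U x
      = \<omega> U / p ^ k * (\<psi> k ((y - Inf U) / p) - \<psi> k ((x - Inf U) / p))"
    by (simp add: gap_term_def p_def right_diff_distrib)
  then have "\<bar>gap_term k U y - gap_term k U x\<bar>
      = \<omega> U / p ^ k * \<bar>\<psi> k ((y - Inf U) / p) - \<psi> k ((x - Inf U) / p)\<bar>"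
    using \<omega>_bounds(1)[OF assms] p by (simp add: abs_mult)
  also have "\<dots> \<le> \<omega> U / p ^ k * (sup_norm (\<psi> (Suc k)) * \<bar>(y - Inf U) / p - (x - Inf U) / p\<bar>)"
    using \<omega>_bounds(1)[OF assms] p by (intro mult_left_mono \<psi>_lipschitz) auto
  also have "(y - Inf U) / p - (x - Inf U) / p = (y - x) / p"
    by (simp add: diff_divide_distrib)
  finally show ?thesis using p by (simp add: p_def mult.assoc abs_divide)
qed

text \<open>The factors are grouped so that the last one is the left side of
  \<open>modulus_scale_le\<close>.\<close>

lemma abs_gap_term_diff_le':
  assumes "coeff_bound k C" "U \<in> D"
  shows "\<bar>gap_term k U y - gap_term k U x\<bar> \<le>
    C * sup_norm (\<psi> (Suc k)) * (modulus \<alpha> (gap_length U) * (\<bar>y - x\<bar> / gap_length U))"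
proof -
  have "\<omega> U / gap_length U ^ k * sup_norm (\<psi> (Suc k)) * (\<bar>y - x\<bar> / gap_length U)
      \<le> C * modulus \<alpha> (gap_length U) * sup_norm (\<psi> (Suc k)) * (\<bar>y - x\<bar> / gap_length U)"
    using assms gap(2)[OF assms(2)] sup_norm_\<psi>_nonneg[of "Suc k"]
    by (intro mult_right_mono) (auto simp: coeff_bound_def)
  then show ?thesis
    using abs_gap_term_diff_le[OF assms(2), of k y x] by (simp add: mult_ac)
qed

text \<open>There is no factor 2 here because two of these bounds are added when \<open>x\<close>
  and \<open>y\<close> have no gap in common.\<close>

lemma abs_gap_term_le:
  assumes C: "coeff_bound k C" and U: "U \<in> D" and k: "1 \<le> k" and x: "x \<in> U" and y: "y \<notin> U"
  shows "\<bar>gap_term k U x\<bar> \<le> C * sup_norm (\<psi> (Suc k)) * modulus \<alpha> \<bar>y - x\<bar>"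
proof -
  have xU: "Inf U < x" "x < Sup U" and yU: "y \<le> Inf U \<or> Sup U \<le> y"
    using gap_mem_iff[OF U, of x] gap_mem_iff[OF U, of y] x y by (simp_all add: not_less)
  \<comment> \<open>The end of \<open>U\<close> nearer to \<open>x\<close> is within half a gap, as
    the scaling bound requires, and no further away than \<open>y\<close>, which lies at or beyond
    one of the two ends.\<close>
  obtain z where z: "z \<notin> U" "\<bar>x - z\<bar> \<le> \<bar>y - x\<bar>" "2 * \<bar>x - z\<bar> \<le> gap_length U"
  proof (cases "x - Inf U \<le> Sup U - x")
    case True
    then show ?thesis
      using xU yU gap_mem_iff[OF U, of "Inf U"]
      by (intro that[of "Inf U"]) (auto simp: gap_length_def)
  next
    case False
    then show ?thesis
      using xU yU gap_mem_iff[OF U, of "Sup U"]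
      by (intro that[of "Sup U"]) (auto simp: gap_length_def)
  qed
  have nonneg: "0 \<le> C * sup_norm (\<psi> (Suc k))"
    using C sup_norm_\<psi>_nonneg[of "Suc k"] by (simp add: coeff_bound_def)
  have "\<bar>gap_term k U x\<bar> = \<bar>gap_term k U x - gap_term k U z\<bar>"
    using gap_term_outside[OF U k z(1)] by simp
  also have "\<dots> \<le> C * sup_norm (\<psi> (Suc k)) * (modulus \<alpha> (gap_length U) * (\<bar>x - z\<bar> / gap_length U))"
    by (rule abs_gap_term_diff_le'[OF C U])
  also have "\<dots> \<le> C * sup_norm (\<psi> (Suc k)) * modulus \<alpha> \<bar>x - z\<bar>"
    using z \<alpha> by (intro mult_left_mono modulus_scale_le nonneg) auto
  also have "\<dots> \<le> C * sup_norm (\<psi> (Suc k)) * modulus \<alpha> \<bar>y - x\<bar>"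
    using z \<alpha> by (intro mult_left_mono modulus_mono nonneg) auto
  finally show ?thesis .
qed

text \<open>Within half a gap the scaling bound applies directly; further apart,
  \<open>t / gap_length U \<le> 1\<close> and the doubling bound costs the factor 2.\<close>

lemma gap_term_equicontinuous:
  assumes C: "coeff_bound k C" and U: "U \<in> D" and x: "x \<in> U" and y: "y \<in> U"
  shows "\<bar>gap_term k U y - gap_term k U x\<bar> \<le> 2 * C * sup_norm (\<psi> (Suc k)) * modulus \<alpha> \<bar>y - x\<bar>"
proof -
  define t where "t = \<bar>y - x\<bar>"
  have pos: "0 < gap_length U" by (rule gap(2)[OF U])
  have t: "0 \<le> t" "t \<le> gap_length U"
    using x y gap_mem_iff[OF U, of x] gap_mem_iff[OF U, of y]
    by (simp_all add: t_def gap_length_def abs_le_iff)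
  have nonneg: "0 \<le> C * sup_norm (\<psi> (Suc k))"
    using C sup_norm_\<psi>_nonneg[of "Suc k"] by (simp add: coeff_bound_def)
  have "modulus \<alpha> (gap_length U) * (t / gap_length U) \<le> 2 * modulus \<alpha> t"
  proof (cases "2 * t \<le> gap_length U")
    case True
    then have "modulus \<alpha> (gap_length U) * (t / gap_length U) \<le> modulus \<alpha> t"
      using \<alpha> t by (intro modulus_scale_le) auto
    then show ?thesis using modulus_nonneg[of \<alpha> t] by linarith
  next
    case False
    have "modulus \<alpha> (gap_length U) * (t / gap_length U) \<le> modulus \<alpha> (gap_length U)"
      using t pos by (intro mult_right_le_one_le modulus_nonneg) auto
    also have "\<dots> \<le> 2 * modulus \<alpha> t"
      using False pos \<alpha> by (intro modulus_le_twice) auto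
    finally show ?thesis .
  qed
  then have "C * sup_norm (\<psi> (Suc k)) * (modulus \<alpha> (gap_length U) * (t / gap_length U))
      \<le> C * sup_norm (\<psi> (Suc k)) * (2 * modulus \<alpha> t)"
    using nonneg by (rule mult_left_mono)
  then show ?thesis
    using abs_gap_term_diff_le'[OF C U, of y x] by (simp add: t_def mult_ac)
qed

text \<open>Since the gaps are disjoint, contributions do not accumulate and the bound is
  independent of \<open>F\<close>. This serves both to differentiate termwise and to carry the
  estimate over to the full sum.\<close>

lemma finite_gap_sum_equicontinuous:
  assumes C: "coeff_bound k C" and k: "1 \<le> k" and F: "finite F" "F \<subseteq> D"
  shows "\<bar>(\<Sum>U\<in>F. gap_term k U y) - (\<Sum>U\<in>F. gap_term k U x)\<bar>
    \<le> 2 * C * sup_norm (\<psi> (Suc k)) * modulus \<alpha> \<bar>y - x\<bar>"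
proof -
  define S where "S z = (\<Sum>U\<in>F. gap_term k U z)" for z
  define q where "q = C * sup_norm (\<psi> (Suc k)) * modulus \<alpha> \<bar>y - x\<bar>"
  have q: "0 \<le> q"
    using C sup_norm_\<psi>_nonneg[of "Suc k"] modulus_nonneg by (simp add: q_def coeff_bound_def)
  have inside: "S z = gap_term k U z" if "U \<in> F" "z \<in> U" for U z
  proof -
    have "S z = (\<Sum>V\<in>{U}. gap_term k V z)"
      unfolding S_def
    proof (rule sum.mono_neutral_right)
      show "\<forall>V\<in>F - {U}. gap_term k V z = 0"
        using that F bounded_gaps_disjoint[of U E] gap_term_outside[OF _ k] by blast
    qed (use that F in auto)
    then show ?thesis by simp
  qed
  have outside: "S z = 0" if "\<And>U. U \<in> F \<Longrightarrow> z \<notin> U" for z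
    unfolding S_def using that F gap_term_outside[OF _ k] by (intro sum.neutral) blast
  \<comment> \<open>Here \<open>z\<close> is either of the two points and \<open>z'\<close> the
    other, so that the gap around \<open>z\<close>, if there is one in \<open>F\<close>, misses
    \<open>z'\<close>.\<close>
  have single: "\<bar>S z\<bar> \<le> q" if eq: "{z, z'} = {x, y}" and sep: "\<not> (\<exists>U\<in>F. z \<in> U \<and> z' \<in> U)" for z z'
  proof (cases "\<exists>U\<in>F. z \<in> U")
    case True
    then obtain U where U: "U \<in> F" "z \<in> U" "z' \<notin> U" using sep by blast
    then have "\<bar>gap_term k U z\<bar> \<le> C * sup_norm (\<psi> (Suc k)) * modulus \<alpha> \<bar>z' - z\<bar>"
      using F by (intro abs_gap_term_le[OF C _ k]) auto
    moreover have "\<bar>z' - z\<bar> = \<bar>y - x\<bar>"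
      using eq by (auto simp: doubleton_eq_iff)
    ultimately show ?thesis using inside[OF U(1,2)] by (simp add: q_def)
  next
    case False
    then show ?thesis using outside[of z] q by auto
  qed
  have "\<bar>S y - S x\<bar> \<le> 2 * q"
  proof (cases "\<exists>U\<in>F. x \<in> U \<and> y \<in> U")
    case True
    then obtain U where U: "U \<in> F" "x \<in> U" "y \<in> U" by blast
    then show ?thesis
      using gap_term_equicontinuous[OF C _ U(2,3)] F inside[OF U(1)] by (auto simp: q_def mult_ac)
  next
    case False
    then have "\<bar>S y\<bar> \<le> q" "\<bar>S x\<bar> \<le> q"
      using single[of y x] single[of x y] by auto
    then show ?thesis by linarith
  qed
  then show ?thesis by (simp add: S_def q_def mult_ac)
qed

section \<open>Convergence and regularity of the full sums\<close>

lemma gap_term_has_sum_pos: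
  assumes "1 \<le> k"
  shows "((\<lambda>U. gap_term k U x) has_sum gap_sum k x) D"
  unfolding gap_sum_def
proof (rule has_sum_infsum, rule finite_nonzero_values_imp_summable_on)
  have "{U \<in> D. gap_term k U x \<noteq> 0} \<subseteq> {U \<in> D. x \<in> U}"
    using gap_term_outside[OF _ assms] by blast
  moreover have "finite {U \<in> D. x \<in> U}"
  proof (cases "{U \<in> D. x \<in> U} = {}")
    case False
    then obtain U where "U \<in> D" "x \<in> U" by blast
    then have "{V \<in> D. x \<in> V} \<subseteq> {U}" using bounded_gaps_disjoint[of U E] by blast
    then show ?thesis using finite_subset by blast
  qed (simp only: finite.emptyI)
  ultimately show "finite {U \<in> D. gap_term k U x \<noteq> 0}" by (rule finite_subset)
qed

lemma \<phi>_bounds: "0 \<le> \<phi> t" "\<phi> t \<le> 1"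
proof -
  show "0 \<le> \<phi> t"
    using monoD[OF mono_\<phi>, of "min t 0" t] \<phi>_left[of "min t 0"] by simp
  show "\<phi> t \<le> 1"
    using monoD[OF mono_\<phi>, of t "max t 1"] \<phi>_right[of "max t 1"] by simp
qed

text \<open>Infinitely many terms may be nonzero at \<open>x\<close>. As m >= 1, the amplitude bound
  at order 1 gives \<open>\<omega> U \<le> C * modulus \<alpha> B * gap_length U\<close>, a summable
  majorant.\<close>

lemma gap_term_0_has_sum: "((\<lambda>U. gap_term 0 U x) has_sum gap_sum 0 x) D"
  unfolding gap_sum_def
proof (rule has_sum_infsum)
  obtain B where B: "0 \<le> B" "\<And>U. U \<in> D \<Longrightarrow> gap_length U \<le> B"
    using gap_length_bounded by blast
  obtain C where C: "coeff_bound 1 C" using coeff_bound_exists[OF m_ge_1] by blast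
  have "(\<lambda>U. C * modulus \<alpha> B * gap_length U) summable_on D"
    by (intro summable_on_cmult_right gap_length_summable compact_E)
  then show "(\<lambda>U. gap_term 0 U x) summable_on D"
  proof (rule summable_on_comparison_test)
    fix U
    assume U: "U \<in> D"
    show "0 \<le> gap_term 0 U x"
      using \<omega>_bounds(1)[OF U] \<phi>_bounds(1) by (simp add: gap_term_def)
    have pos: "0 < gap_length U" by (rule gap(2)[OF U])
    have "gap_term 0 U x \<le> \<omega> U"
      using \<omega>_bounds(1)[OF U] \<phi>_bounds by (auto simp: gap_term_def intro: mult_left_le)
    also have "\<dots> \<le> C * modulus \<alpha> (gap_length U) * gap_length U"
      using C U pos by (auto simp: coeff_bound_def divide_le_eq)
    also have "\<dots> \<le> C * modulus \<alpha> B * gap_length U"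
      using C B(2)[OF U] pos \<alpha>
      by (intro mult_right_mono mult_left_mono modulus_mono) (auto simp: coeff_bound_def)
    finally show "gap_term 0 U x \<le> C * modulus \<alpha> B * gap_length U" .
  qed
qed

lemma gap_term_has_sum: "((\<lambda>U. gap_term k U x) has_sum gap_sum k x) D"
proof (cases "k = 0")
  case True
  then show ?thesis by (simp only: gap_term_0_has_sum)
next
  case False
  then show ?thesis by (intro gap_term_has_sum_pos) simp
qed

lemma gap_term_deriv:
  assumes "U \<in> D"
  shows "(gap_term k U has_real_derivative gap_term (Suc k) U x) (at x)"
proof -
  have "((\<lambda>x. (x - Inf U) / gap_length U) has_real_derivative 1 / gap_length U) (at x)"
    using gap(2)[OF assms] by (auto intro!: derivative_eq_intros)
  from DERIV_cmult[OF DERIV_chain2[OF C_infinity_higher_deriv(1)[OF smooth] this],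
      of "\<omega> U / gap_length U ^ k" k]
  show ?thesis by (simp add: gap_term_def[abs_def] mult_ac)
qed

text \<open>Only the differentiated terms, of order \<open>Suc k\<close>, have to be equicontinuous;
  this covers \<open>k = 0\<close>, and \<open>k < m\<close> provides their amplitude bound.\<close>

lemma gap_sum_deriv:
  assumes "k < m"
  shows "(gap_sum k has_real_derivative gap_sum (Suc k) x) (at x)"
proof -
  from assms have "Suc k \<le> m" by simp
  then obtain C where C: "coeff_bound (Suc k) C" by (rule coeff_bound_exists)
  define w where "w t = 2 * C * sup_norm (\<psi> (Suc (Suc k))) * modulus \<alpha> t" for t
  show ?thesis
  proof (rule has_real_derivative_has_sum[where D = D and w = w])
    show "(w \<longlongrightarrow> 0) (at_right 0)"
      unfolding w_def by (intro tendsto_mult_right_zero modulus_tendsto_0 \<alpha>)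
    show "w s \<le> w t" if "0 \<le> s" "s \<le> t" for s t
      unfolding w_def using that C \<alpha> sup_norm_\<psi>_nonneg[of "Suc (Suc k)"]
      by (intro mult_left_mono modulus_mono) (auto simp: coeff_bound_def)
    show "\<bar>(\<Sum>U\<in>F. gap_term (Suc k) U y) - (\<Sum>U\<in>F. gap_term (Suc k) U x)\<bar> \<le> w \<bar>y - x\<bar>"
      if "finite F" "F \<subseteq> D" for F x y
      unfolding w_def by (rule finite_gap_sum_equicontinuous[OF C _ that]) simp
  qed (rule gap_term_deriv gap_term_has_sum; assumption?)+
qed

lemma gap_sum_equicontinuous:
  assumes C: "coeff_bound k C" and k: "1 \<le> k"
  shows "\<bar>gap_sum k y - gap_sum k x\<bar> \<le> 2 * C * sup_norm (\<psi> (Suc k)) * modulus \<alpha> \<bar>y - x\<bar>"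
proof (rule tendsto_upperbound)
  show "((\<lambda>F. \<bar>(\<Sum>U\<in>F. gap_term k U y) - (\<Sum>U\<in>F. gap_term k U x)\<bar>)
      \<longlongrightarrow> \<bar>gap_sum k y - gap_sum k x\<bar>) (finite_subsets_at_top D)"
    using gap_term_has_sum unfolding has_sum_def by (intro tendsto_intros) auto
  show "\<forall>\<^sub>F F in finite_subsets_at_top D.
      \<bar>(\<Sum>U\<in>F. gap_term k U y) - (\<Sum>U\<in>F. gap_term k U x)\<bar>
        \<le> 2 * C * sup_norm (\<psi> (Suc k)) * modulus \<alpha> \<bar>y - x\<bar>"
    using finite_gap_sum_equicontinuous[OF C k]
    by (intro eventually_finite_subsets_at_top_weakI) auto
qed simp

lemma gap_sum_bounded_Hoelder:
  assumes k: "1 \<le> k" "k \<le> m"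
  shows "bounded_Hoelder \<alpha> (gap_sum k)"
proof -
  obtain C where C: "coeff_bound k C" using k(2) by (rule coeff_bound_exists)
  define K where "K = 2 * C * sup_norm (\<psi> (Suc k))"
  have K: "0 \<le> K"
    using C sup_norm_\<psi>_nonneg[of "Suc k"] by (simp add: K_def coeff_bound_def)
  have equi: "\<bar>gap_sum k y - gap_sum k x\<bar> \<le> K * modulus \<alpha> \<bar>y - x\<bar>" for x y
    unfolding K_def by (rule gap_sum_equicontinuous[OF C k(1)])
  obtain R where R: "\<And>U. U \<in> D \<Longrightarrow> U \<subseteq> {-R..R}"
    using bounded_gaps_subset_Icc[OF compact_E] by blast
  have zero: "gap_sum k x = 0" if "x \<notin> {-R..R}" for x
    unfolding gap_sum_def using that R gap_term_outside[OF _ k(1)] by (intro infsum_0) blast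
  have "\<bar>gap_sum k x\<bar> \<le> K * modulus \<alpha> (2 * \<bar>R\<bar> + 1)" for x
  proof (cases "x \<in> {-R..R}")
    case True
    \<comment> \<open>The point \<open>\<bar>R\<bar> + 1\<close> lies outside all gaps, where the
      sum is 0, so equicontinuity over the distance to it bounds the value.\<close>
    have "\<bar>gap_sum k x\<bar> \<le> K * modulus \<alpha> \<bar>x - (\<bar>R\<bar> + 1)\<bar>"
      using equi[of x "\<bar>R\<bar> + 1"] zero[of "\<bar>R\<bar> + 1"] by force
    also have "\<dots> \<le> K * modulus \<alpha> (2 * \<bar>R\<bar> + 1)"
      using True K \<alpha> by (intro mult_left_mono modulus_mono) auto
    finally show ?thesis .
  next
    case False
    then show ?thesis using zero K modulus_nonneg by simp
  qed
  moreover have "Hoelder_continuous \<alpha> (gap_sum k)" if "0 < \<alpha>"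
  proof -
    \<comment> \<open>This includes \<open>t = 0\<close>, where
      \<open>0 powr \<alpha> = 0\<close>.\<close>
    have "modulus \<alpha> t = t powr \<alpha>" for t
      using that by (simp add: modulus_def)
    then show ?thesis using equi unfolding Hoelder_continuous_def by auto
  qed
  ultimately show ?thesis
    using continuous_on_if_modulus[OF \<alpha>(1) equi] unfolding bounded_Hoelder_def by blast
qed

lemma gap_sum_C_bounded_Hoelder:
  assumes "1 \<le> k" "k + j \<le> m"
  shows "C_bounded_Hoelder \<alpha> j (gap_sum k)"
  using assms
proof (induction j arbitrary: k)
  case 0
  then show ?case by (simp add: gap_sum_bounded_Hoelder)
next
  case (Suc j)
  then show ?case
    by (intro C_bounded_Hoelder_deriv_I[OF gap_sum_bounded_Hoelder gap_sum_deriv Suc.IH]) auto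
qed

section \<open>The functions \<open>f_param\<close>\<close>

lemma f_param_eq: "f_param E \<phi> \<omega> = (\<lambda>x. x + gap_sum 0 x)"
  by (simp add: fun_eq_iff f_param_def gap_sum_def gap_term_def)

lemma f_param_deriv: "(f_param E \<phi> \<omega> has_real_derivative 1 + gap_sum 1 x) (at x)"
  unfolding f_param_eq using gap_sum_deriv[of 0 x] m_ge_1 by (auto intro!: derivative_eq_intros)

lemma gap_sum_1_nonneg: "0 \<le> gap_sum 1 x"
  unfolding gap_sum_def
proof (rule infsum_nonneg)
  fix U
  assume U: "U \<in> D"
  have "0 \<le> \<psi> 1 t" for t
    using mono_\<phi> C_infinity_higher_deriv(1)[OF smooth, of 0 t]
    by (intro mono_on_imp_deriv_nonneg[of UNIV \<phi>]) (auto simp: mono_on_def mono_def)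
  then show "0 \<le> gap_term 1 U x"
    using \<omega>_bounds(1)[OF U] gap(2)[OF U] by (simp add: gap_term_def)
qed

lemma f_param_diffeomorphism: "diffeomorphism m \<alpha> (f_param E \<phi> \<omega>)"
proof -
  have "C_bounded_Hoelder \<alpha> (m - 1) (\<lambda>x. 1 + gap_sum 1 x)"
    using m_ge_1
    by (intro C_bounded_Hoelder_add C_bounded_Hoelder_const gap_sum_C_bounded_Hoelder) auto
  from diffeomorphism_if_deriv_ge_1[OF f_param_deriv _ this]
  show ?thesis using gap_sum_1_nonneg m_ge_1 by simp
qed

text \<open>The summand \<open>x\<close> leaves only a constant, which cancels in differences of
  values.\<close>

lemma f_param_higher_deriv:
  assumes "1 \<le> k" "k \<le> m"
  shows "(deriv ^^ k) (f_param E \<phi> \<omega>) = (\<lambda>x. (if k = 1 then 1 else 0) + gap_sum k x)"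
  using assms
proof (induction k rule: nat_induct_at_least)
  case base
  show ?case using f_param_deriv by (auto intro: DERIV_imp_deriv)
next
  case (Suc k)
  have "((\<lambda>x. (if k = 1 then 1 else 0) + gap_sum k x) has_real_derivative gap_sum (Suc k) x) (at x)"
    for x
    using gap_sum_deriv[of k x] Suc.prems by (auto intro!: derivative_eq_intros)
  then show ?case
    using Suc DERIV_imp_deriv by fastforce
qed

text \<open>The bounds defining \<open>parameters\<close> amount to \<open>C = 1\<close> at order
  \<open>m\<close>, so the constant \<open>2 * C\<close> becomes 2.\<close>

lemma f_param_equicontinuous:
  "\<bar>(deriv ^^ m) (f_param E \<phi> \<omega>) y - (deriv ^^ m) (f_param E \<phi> \<omega>) x\<bar>
    \<le> 2 * sup_norm ((deriv ^^ (m + 1)) \<phi>) * modulus \<alpha> \<bar>y - x\<bar>"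
  using gap_sum_equicontinuous[OF coeff_bound_m m_ge_1, of y x]
  unfolding f_param_higher_deriv[OF m_ge_1 order_refl] by simp

end

theorem theorem3:
  fixes E :: "real set" and m :: nat and \<alpha> :: real and \<phi> :: "real \<Rightarrow> real"
  assumes "compact E"
    and "m \<ge> 1"
    and "0 \<le> \<alpha>" and "\<alpha> \<le> 1"
    and "mono \<phi>" and "C_infinity \<phi>"
    and "\<And>x. x \<le> 0 \<Longrightarrow> \<phi> x = 0"
    and "\<And>x. x \<ge> 1 \<Longrightarrow> \<phi> x = 1"
  shows "(\<forall>\<omega>\<in>parameters E m \<alpha>. diffeomorphism m \<alpha> (f_param E \<phi> \<omega>)) \<and>
    (\<forall>\<omega>\<in>parameters E m \<alpha>. \<forall>x y.
       \<bar>(deriv ^^ m) (f_param E \<phi> \<omega>) y - (deriv ^^ m) (f_param E \<phi> \<omega>) x\<bar>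
         \<le> 2 * sup_norm ((deriv ^^ (m + 1)) \<phi>) * modulus \<alpha> \<bar>y - x\<bar>)"
proof -
  have family: "gap_family E m \<alpha> \<phi> \<omega>" if "\<omega> \<in> parameters E m \<alpha>" for \<omega>
    using assms that by unfold_locales auto
  then show ?thesis
    using gap_family.f_param_diffeomorphism gap_family.f_param_equicontinuous by blast
qed

end
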